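(* Let $\Phi=(G,\varphi)$ be a $\mathbb{T}$-gain graph on a connected simple graph $G$ with at least one edge, and let $m$ be the number of edges of $G$. Then $\mathcal{E}(\Phi)\geq \frac{2m}{\rho(G)}$. Equality holds if and only if $\Phi$ is balanced and $G$ is a complete bipartite graph.
   Context: Let $\mathbb{T}=\{z\in\mathbb{C}:|z|=1\}$. A $\mathbb{T}$-gain graph $\Phi=(G,\varphi)$ is a simple graph $G$ with a map $\varphi$ assigning to each oriented edge $\vec e_{p,q}$ a value in $\mathbb{T}$ with $\varphi(\vec{e}_{p,q})=\varphi(\vec{e}_{q,p})^{-1}$. Its adjacency matrix $A(\Phi)$ is the Hermitian matrix with $(p,q)$ entry $\varphi(\vec{e}_{p,q})$ if $v_p\sim v_q$ and $0$ otherwise. The energy $\mathcal{E}(\Phi)$ is the sum of the absolute values of the eigenvalues of $A(\Phi)$. The gain of a cycle $v_1\sim\cdots\sim v_k\sim v_1$ is the product $\varphi(\vec e_{1,2})\cdots\varphi(\vec e_{k,1})$; $\Phi$ is balanced if every cycle has gain $1$. $\rho(G)$ is the spectral radius of the ordinary adjacency matrix of $G$. *)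

theory Defs
  imports
    "Graph_Theory.Kuratowski"
    "Jordan_Normal_Form.Spectral_Radius"
begin

text \<open>
  A finite simple graph is a \<open>pair_graph\<close>: every undirected edge is represented by its two
  orientations in \<open>parcs G\<close>, so that a gain function is a function on the oriented edges.
\<close>

locale T_gain_graph = pair_graph G for G :: "'a pair_pre_digraph" +
  fixes \<phi> :: "'a \<times> 'a \<Rightarrow> complex"
  assumes gain_in_circle: "\<And>p q. (p, q) \<in> parcs G \<Longrightarrow> cmod (\<phi> (p, q)) = 1"
    and gain_reverse: "\<And>p q. (p, q) \<in> parcs G \<Longrightarrow> \<phi> (p, q) = inverse (\<phi> (q, p))"

definition undirected_edges :: "'a pair_pre_digraph \<Rightarrow> 'a set set" where
  "undirected_edges G = {{p, q} | p q. (p, q) \<in> parcs G}"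

text \<open>A labelling \<open>v\<^sub>1, \<dots>, v\<^sub>n\<close> of the vertices, which fixes the order of rows and columns.\<close>

definition vertex_enum :: "'a list \<Rightarrow> 'a pair_pre_digraph \<Rightarrow> bool" where
  "vertex_enum vs G \<longleftrightarrow> distinct vs \<and> set vs = pverts G"

definition gain_adjacency ::
  "'a list \<Rightarrow> 'a pair_pre_digraph \<Rightarrow> ('a \<times> 'a \<Rightarrow> complex) \<Rightarrow> complex mat" where
  "gain_adjacency vs G \<phi> = mat (length vs) (length vs)
     (\<lambda>(i, j). if (vs ! i, vs ! j) \<in> parcs G then \<phi> (vs ! i, vs ! j) else 0)"

definition adjacency :: "'a list \<Rightarrow> 'a pair_pre_digraph \<Rightarrow> complex mat" where
  "adjacency vs G = mat (length vs) (length vs)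
     (\<lambda>(i, j). if (vs ! i, vs ! j) \<in> parcs G then 1 else 0)"

text \<open>
  Eigenvalues are counted with multiplicity, as roots of the characteristic polynomial.
\<close>

definition gain_energy ::
  "'a list \<Rightarrow> 'a pair_pre_digraph \<Rightarrow> ('a \<times> 'a \<Rightarrow> complex) \<Rightarrow> real" where
  "gain_energy vs G \<phi> = (\<Sum>z\<in>#proots (char_poly (gain_adjacency vs G \<phi>)). cmod z)"

definition graph_spectral_radius :: "'a list \<Rightarrow> 'a pair_pre_digraph \<Rightarrow> real" where
  "graph_spectral_radius vs G = spectral_radius (adjacency vs G)"

text \<open>
  A cycle is a closed walk of oriented edges, given as a list. The library's \<open>cycle\<close> also admits
  an edge traversed back and forth, which is not a cycle of a simple graph, hence the length bound.
\<close>

definition balanced :: "'a pair_pre_digraph \<Rightarrow> ('a \<times> 'a \<Rightarrow> complex) \<Rightarrow> bool" where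
  "balanced G \<phi> \<longleftrightarrow>
     (\<forall>c. pre_digraph.cycle (with_proj G) c \<and> length c \<ge> 3 \<longrightarrow> prod_list (map \<phi> c) = 1)"

definition complete_bipartite :: "'a pair_pre_digraph \<Rightarrow> bool" where
  "complete_bipartite G \<longleftrightarrow>
     (\<exists>a b. a \<ge> 1 \<and> b \<ge> 1 \<and> complete_bipartite_digraph a b (with_proj G))"

end

theory Submission
  imports Defs "HOL-Analysis.Convex"
begin

text \<open>
  Write \<open>A\<close> for the gain adjacency matrix and \<open>B = |A|\<close> for the ordinary one. Traces of powers are
  power sums of eigenvalues, so the squares of the eigenvalues of \<open>A\<close> add up to \<open>2 m\<close>; and
  \<open>|z| \<le> \<rho>(G)\<close> for every eigenvalue \<open>z\<close>, because an eigenvector \<open>x\<close> satisfies \<open>|z| |x| \<le> B |x|\<close>.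
  Hence \<open>\<rho>(G) \<E>(\<Phi>) \<ge> 2 m\<close>, with equality iff all eigenvalues lie in \<open>{0, \<rho>(G), -\<rho>(G)}\<close>.

  In the equality case \<open>A\<^sup>3 = \<rho>(G)\<^sup>2 A\<close>, while an eigenvector of an extremal eigenvalue shows that
  \<open>A\<close> is \<open>\<plusminus>B\<close> up to conjugation by a diagonal matrix of phases. Therefore walks of length three do
  not cancel in \<open>A\<^sup>3\<close>, and the ends of every such walk are adjacent; in a connected graph this forces
  complete bipartiteness, and then the sign can be absorbed into one of the two parts. Conversely, if
  \<open>G\<close> is complete bipartite with parts of sizes \<open>a\<close> and \<open>b\<close> and \<open>\<Phi>\<close> is balanced, a walk of length three
  has the gain of the edge between its ends, so \<open>z\<^sup>3 = a b z\<close> for all eigenvalues of both \<open>A\<close> and \<open>B\<close>.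
\<close>

section \<open>Traces and Hermitian matrices\<close>

definition mat_trace :: "'a::comm_ring_1 mat \<Rightarrow> 'a" where
  "mat_trace A = (\<Sum>i<dim_row A. A $$ (i, i))"

definition hermitian_mat :: "complex mat \<Rightarrow> bool" where
  "hermitian_mat A \<longleftrightarrow> (\<forall>i<dim_row A. \<forall>j<dim_row A. A $$ (i, j) = cnj (A $$ (j, i)))"

definition vec_norm2 :: "complex vec \<Rightarrow> real" where
  "vec_norm2 v = (\<Sum>i<dim_vec v. (cmod (v $ i))\<^sup>2)"

definition frobenius2 :: "complex mat \<Rightarrow> real" where
  "frobenius2 A = (\<Sum>i<dim_row A. \<Sum>j<dim_col A. (cmod (A $$ (i, j)))\<^sup>2)"

lemma hermitian_matD:
  "hermitian_mat A \<Longrightarrow> i < dim_row A \<Longrightarrow> j < dim_row A \<Longrightarrow> A $$ (i, j) = cnj (A $$ (j, i))"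
  unfolding hermitian_mat_def by blast

lemma hermitian_matI:
  "(\<And>i j. i < dim_row A \<Longrightarrow> j < dim_row A \<Longrightarrow> A $$ (i, j) = cnj (A $$ (j, i))) \<Longrightarrow> hermitian_mat A"
  unfolding hermitian_mat_def by blast

lemma index_mult_mat_sum:
  assumes "A \<in> carrier_mat n k" "B \<in> carrier_mat k m" "i < n" "j < m"
  shows "(A * B) $$ (i, j) = (\<Sum>l<k. A $$ (i, l) * B $$ (l, j))"
  using assms by (auto simp: scalar_prod_def atLeast0LessThan)

lemma index_mult_mat_vec_sum:
  assumes "A \<in> carrier_mat n k" "v \<in> carrier_vec k" "i < n"
  shows "(A *\<^sub>v v) $ i = (\<Sum>l<k. A $$ (i, l) * v $ l)"
  using assms by (auto simp: scalar_prod_def atLeast0LessThan)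

section \<open>Traces of powers as power sums of eigenvalues\<close>

lemma mat_trace_comm:
  assumes "A \<in> carrier_mat n k" "B \<in> carrier_mat k n"
  shows "mat_trace (A * B) = mat_trace (B * A)"
proof -
  have "mat_trace (A * B) = (\<Sum>i<n. \<Sum>l<k. A $$ (i, l) * B $$ (l, i))"
    unfolding mat_trace_def using assms by (intro sum.cong) (auto simp: index_mult_mat_sum simp del: index_mult_mat(1))
  also have "\<dots> = (\<Sum>l<k. \<Sum>i<n. B $$ (l, i) * A $$ (i, l))"
    by (subst sum.swap) (simp add: mult.commute)
  also have "\<dots> = mat_trace (B * A)"
    unfolding mat_trace_def using assms by (intro sum.cong) (auto simp: index_mult_mat_sum simp del: index_mult_mat(1))
  finally show ?thesis .
qed

lemma mat_trace_similar:
  assumes "similar_mat_wit A B P Q"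
  shows "mat_trace A = mat_trace B"
proof -
  define n where "n = dim_row A"
  note w = similar_mat_witD[OF n_def assms]
  have "mat_trace A = mat_trace (P * (B * Q))" using w by (simp add: assoc_mult_mat[of _ n n _ n _ n])
  also have "\<dots> = mat_trace ((B * Q) * P)" by (rule mat_trace_comm[of _ n n]) (use w in auto)
  also have "(B * Q) * P = B" using w by (simp add: assoc_mult_mat[of _ n n _ n _ n])
  finally show ?thesis .
qed

text \<open>In the row-by-column sum, a term with \<open>l < i\<close> has its left factor below the
  diagonal, and a term with \<open>l > j\<close> has its right factor there. Only
  \<open>l = i = j\<close> survives.\<close>

lemma upper_triangular_mult_entry:
  fixes A :: "'a::comm_ring_1 mat"
  assumes "A \<in> carrier_mat n n" "B \<in> carrier_mat n n" "upper_triangular A" "upper_triangular B"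
    and "i < n" "j \<le> i"
  shows "(A * B) $$ (i, j) = (if i = j then A $$ (i, i) * B $$ (i, i) else 0)"
proof -
  have j: "j < n" using assms by simp
  have z: "A $$ (i, l) * B $$ (l, j) = 0" if "l < n" "l \<noteq> i \<or> i \<noteq> j" for l
  proof (cases "l < i")
    case True
    then show ?thesis using upper_triangularD[OF assms(3), of l i] assms by simp
  next
    case False
    then have "j < l" using that assms by auto
    then show ?thesis using upper_triangularD[OF assms(4), of j l] assms that by simp
  qed
  have "(A * B) $$ (i, j) = (\<Sum>l<n. A $$ (i, l) * B $$ (l, j))"
    using assms j by (intro index_mult_mat_sum)
  also have "\<dots> = (\<Sum>l<n. if l = i then if i = j then A $$ (i, i) * B $$ (i, i) else 0 else 0)"
    by (intro sum.cong) (use z assms in auto)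
  also have "\<dots> = (if i = j then A $$ (i, i) * B $$ (i, i) else 0)"
    using assms by simp
  finally show ?thesis .
qed

lemma upper_triangular_pow:
  fixes A :: "'a::comm_ring_1 mat"
  assumes A: "A \<in> carrier_mat n n" "upper_triangular A"
  shows "upper_triangular (A ^\<^sub>m k) \<and> (\<forall>i<n. (A ^\<^sub>m k) $$ (i, i) = A $$ (i, i) ^ k)"
proof (induction k)
  case 0
  then show ?case using A by auto
next
  case (Suc k)
  have c: "A ^\<^sub>m k \<in> carrier_mat n n" using A by simp
  note e = upper_triangular_mult_entry[OF c A(1) _ A(2)]
  show ?case using Suc e A c by (auto intro!: upper_triangularI simp: mult.commute simp del: index_mult_mat(1))
qed

text \<open>Schur decomposition makes \<open>A\<close> similar to a triangular matrix whose diagonal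
  lists the roots of the characteristic polynomial with multiplicity. Powers respect both similarity
  and triangularity, and the trace is invariant under similarity.\<close>

lemma mat_trace_pow:
  fixes A :: "complex mat"
  assumes A: "A \<in> carrier_mat n n"
  shows "mat_trace (A ^\<^sub>m k) = (\<Sum>z\<in>#proots (char_poly A). z ^ k)"
proof -
  obtain es where es: "char_poly A = (\<Prod>a\<leftarrow>es. [:- a, 1:])" "length es = n"
    using char_poly_factorized[OF A] by blast
  have pr: "proots (char_poly A) = mset es"
  proof -
    have "proots (\<Prod>a\<leftarrow>es. [:- a, 1:]) = mset es" for es :: "complex list"
      proof (induction es)
      case (Cons a es)
      have "(\<Prod>a\<leftarrow>es. [:- a, 1:]) \<noteq> 0" by (auto simp: prod_list_zero_iff)
      then have "proots ([:- a, 1:] * (\<Prod>a\<leftarrow>es. [:- a, 1:])) = proots [:- a, 1:] + mset es"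
        using Cons by (subst proots_mult) auto
      then show ?case by (simp del: mult_pCons_left)
    qed simp
    then show ?thesis using es by simp
  qed
  obtain B P Q where "schur_decomposition A es = (B, P, Q)"
    by (cases "schur_decomposition A es") auto
  with schur_decomposition[OF A es(1)] have sd: "similar_mat_wit A B P Q" "upper_triangular B" "diag_mat B = es"
    by auto
  have B: "B \<in> carrier_mat n n" using similar_mat_witD2[OF A sd(1)] by simp
  have "mat_trace (A ^\<^sub>m k) = mat_trace (B ^\<^sub>m k)"
    by (rule mat_trace_similar[OF similar_mat_wit_pow[OF sd(1)]])
  also have "\<dots> = (\<Sum>i<n. es ! i ^ k)"
    unfolding mat_trace_def using upper_triangular_pow[OF B sd(2)] B sd(3)
    by (auto intro!: sum.cong simp: diag_mat_def)
  also have "\<dots> = (\<Sum>z\<leftarrow>es. z ^ k)"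
    using es(2) by (simp add: sum_list_sum_nth atLeast0LessThan)
  finally show ?thesis by (simp add: pr flip: sum_mset_sum_list)
qed

lemma set_mset_proots_char_poly:
  fixes A :: "complex mat"
  assumes A: "A \<in> carrier_mat n n"
  shows "set_mset (proots (char_poly A)) = spectrum A"
proof -
  have "char_poly A \<noteq> 0" using degree_monic_char_poly[OF A] by auto
  then show ?thesis using spectrum_root_char_poly[OF A] by simp
qed

lemma size_proots_char_poly:
  fixes A :: "complex mat"
  assumes A: "A \<in> carrier_mat n n"
  shows "size (proots (char_poly A)) = n"
  using degree_monic_char_poly[OF A] by (simp add: size_proots_complex)

section \<open>Hermitian matrices: Frobenius norm and inner product\<close>

lemma mat_trace_mult_hermitian:
  assumes "A \<in> carrier_mat n n" "B \<in> carrier_mat n n" "hermitian_mat B"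
  shows "mat_trace (A * B) = (\<Sum>i<n. \<Sum>j<n. A $$ (i, j) * cnj (B $$ (i, j)))"
proof -
  have "mat_trace (A * B) = (\<Sum>i<n. \<Sum>j<n. A $$ (i, j) * B $$ (j, i))"
    unfolding mat_trace_def using assms
    by (auto intro!: sum.cong simp: index_mult_mat_sum simp del: index_mult_mat(1))
  also have "\<dots> = (\<Sum>i<n. \<Sum>j<n. A $$ (i, j) * cnj (B $$ (i, j)))"
    using assms(2) by (intro sum.cong refl arg_cong2[where f="(*)"] hermitian_matD[OF assms(3)]) auto
  finally show ?thesis .
qed

text \<open>Links the size of the entries to the spectrum: the trace on the right is a power sum of
  eigenvalues.\<close>

lemma frobenius2_hermitian:
  assumes "A \<in> carrier_mat n n" "hermitian_mat A"
  shows "complex_of_real (frobenius2 A) = mat_trace (A * A)"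
  unfolding mat_trace_mult_hermitian[OF assms(1) assms(1,2)] frobenius2_def using assms
  by (simp add: complex_mult_cnj cmod_power2)

lemma pow_mat_add:
  assumes A: "A \<in> carrier_mat n n"
  shows "A ^\<^sub>m (k + l) = (A ^\<^sub>m k) * (A ^\<^sub>m l)"
proof (induction l)
  case 0
  then show ?case using A by (simp add: right_mult_one_mat[of _ n n])
next
  case (Suc l)
  then show ?case using A by (simp add: assoc_mult_mat[of _ n n _ n _ n])
qed

lemma hermitian_mat_pow:
  assumes "A \<in> carrier_mat n n" "hermitian_mat A"
  shows "hermitian_mat (A ^\<^sub>m k)"
proof (induction k)
  case 0
  then show ?case by (intro hermitian_matI) auto
next
  case (Suc k)
  have c: "A ^\<^sub>m k \<in> carrier_mat n n" using assms by simp
  \<comment> \<open>Conjugate transposition reverses the order of the factors, so the product is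
    Hermitian only because they commute.\<close>
  have cA: "(A ^\<^sub>m k) * A = A * (A ^\<^sub>m k)"
    using pow_mat_add[OF assms(1), of 1 k] pow_mat_add[OF assms(1), of k 1] assms by (simp add: add.commute)
  have e: "((A ^\<^sub>m k) * A) $$ (i, j) = cnj (((A ^\<^sub>m k) * A) $$ (j, i))" if "i < n" "j < n" for i j
  proof -
    have "((A ^\<^sub>m k) * A) $$ (i, j) = (\<Sum>l<n. (A ^\<^sub>m k) $$ (i, l) * A $$ (l, j))"
      using that by (intro index_mult_mat_sum[of _ n n _ n] assms c)
    also have "\<dots> = (\<Sum>l<n. cnj (A $$ (j, l) * (A ^\<^sub>m k) $$ (l, i)))"
    proof (intro sum.cong refl)
      fix l assume "l \<in> {..<n}"
      then have "(A ^\<^sub>m k) $$ (i, l) = cnj ((A ^\<^sub>m k) $$ (l, i))" "A $$ (l, j) = cnj (A $$ (j, l))"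
        using Suc assms that c by (auto intro!: hermitian_matD)
      then show "(A ^\<^sub>m k) $$ (i, l) * A $$ (l, j) = cnj (A $$ (j, l) * (A ^\<^sub>m k) $$ (l, i))"
        by (simp add: mult.commute)
    qed
    also have "\<dots> = cnj ((A * (A ^\<^sub>m k)) $$ (j, i))"
      using that by (subst index_mult_mat_sum[OF assms(1) c]) auto
    also have "A * (A ^\<^sub>m k) = (A ^\<^sub>m k) * A" by (rule cA[symmetric])
    finally show ?thesis .
  qed
  show ?case unfolding pow_mat.simps(2)
    by (rule hermitian_matI, rule e) (use assms c in auto)
qed

lemma hermitian_mult_vec_inner:
  assumes A: "A \<in> carrier_mat n n" "hermitian_mat A" and v: "v \<in> carrier_vec n" and w: "w \<in> carrier_vec n"
  shows "(\<Sum>i<n. (A *\<^sub>v v) $ i * cnj (w $ i)) = (\<Sum>i<n. v $ i * cnj ((A *\<^sub>v w) $ i))"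
proof -
  have "(\<Sum>i<n. (A *\<^sub>v v) $ i * cnj (w $ i)) = (\<Sum>i<n. \<Sum>j<n. A $$ (i, j) * v $ j * cnj (w $ i))"
    using A v by (simp add: index_mult_mat_vec_sum sum_distrib_right del: index_mult_mat_vec)
  also have "\<dots> = (\<Sum>j<n. \<Sum>i<n. A $$ (i, j) * v $ j * cnj (w $ i))" by (rule sum.swap)
  also have "\<dots> = (\<Sum>j<n. v $ j * (\<Sum>i<n. cnj (A $$ (j, i)) * cnj (w $ i)))"
    unfolding sum_distrib_left
  proof (intro sum.cong refl)
    fix i j assume "i \<in> {..<n}" "j \<in> {..<n}"
    then have "A $$ (i, j) = cnj (A $$ (j, i))" using A by (intro hermitian_matD) auto
    then show "A $$ (i, j) * v $ j * cnj (w $ i) = v $ j * (cnj (A $$ (j, i)) * cnj (w $ i))" by simp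
  qed
  also have "\<dots> = (\<Sum>i<n. v $ i * cnj ((A *\<^sub>v w) $ i))"
    using A w by (simp add: index_mult_mat_vec_sum del: index_mult_mat_vec)
  finally show ?thesis .
qed

section \<open>Norm estimates by the spectral radius\<close>

lemma cmod_sum_mult_squared_le:
  fixes f g :: "'b \<Rightarrow> complex"
  shows "(cmod (\<Sum>i\<in>S. f i * g i))\<^sup>2 \<le> (\<Sum>i\<in>S. (cmod (f i))\<^sup>2) * (\<Sum>i\<in>S. (cmod (g i))\<^sup>2)"
proof -
  have "cmod (\<Sum>i\<in>S. f i * g i) \<le> (\<Sum>i\<in>S. cmod (f i) * cmod (g i))"
    by (rule order_trans[OF norm_sum]) (simp add: norm_mult)
  then have "(cmod (\<Sum>i\<in>S. f i * g i))\<^sup>2 \<le> (\<Sum>i\<in>S. cmod (f i) * cmod (g i))\<^sup>2"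
    by (intro power_mono) auto
  also have "\<dots> \<le> (\<Sum>i\<in>S. (cmod (f i))\<^sup>2) * (\<Sum>i\<in>S. (cmod (g i))\<^sup>2)"
    by (rule Cauchy_Schwarz_ineq_sum)
  finally show ?thesis .
qed

lemma vec_norm2_mult_le_frobenius2:
  assumes "A \<in> carrier_mat n m" "v \<in> carrier_vec m"
  shows "vec_norm2 (A *\<^sub>v v) \<le> frobenius2 A * vec_norm2 v"
  proof -
  have "vec_norm2 (A *\<^sub>v v) = (\<Sum>i<n. (cmod (\<Sum>l<m. A $$ (i, l) * v $ l))\<^sup>2)"
    using assms by (auto intro!: sum.cong simp: vec_norm2_def index_mult_mat_vec_sum simp del: index_mult_mat_vec)
  also have "\<dots> \<le> (\<Sum>i<n. (\<Sum>l<m. (cmod (A $$ (i, l)))\<^sup>2) * (\<Sum>l<m. (cmod (v $ l))\<^sup>2))"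
    by (intro sum_mono cmod_sum_mult_squared_le)
  also have "\<dots> = frobenius2 A * vec_norm2 v"
    using assms by (simp add: frobenius2_def vec_norm2_def sum_distrib_right)
  finally show ?thesis .
qed

lemma vec_norm2_nonneg: "vec_norm2 v \<ge> 0"
  by (simp add: vec_norm2_def sum_nonneg)

lemma vec_norm2_eq_0_iff: "vec_norm2 v = 0 \<longleftrightarrow> v = 0\<^sub>v (dim_vec v)"
  by (auto simp: vec_norm2_def sum_nonneg_eq_0_iff vec_eq_iff)

text \<open>With \<open>w = A v\<close>, self-adjointness moves one factor across the inner product:
  the squared norm of \<open>w\<close> is the inner product of \<open>v\<close> with
  \<open>A w\<close>. Cauchy-Schwarz finishes.\<close>

lemma vec_norm2_mult_log_convex:
  assumes A: "A \<in> carrier_mat n n" "hermitian_mat A" and v: "v \<in> carrier_vec n"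
  shows "(vec_norm2 (A *\<^sub>v v))\<^sup>2 \<le> vec_norm2 v * vec_norm2 (A *\<^sub>v (A *\<^sub>v v))"
proof -
  define w where "w = A *\<^sub>v v"
  have w: "w \<in> carrier_vec n" using A v by (simp add: w_def)
  have "complex_of_real (vec_norm2 w) = (\<Sum>i<n. w $ i * cnj (w $ i))"
    using w by (simp add: vec_norm2_def complex_mult_cnj cmod_power2)
  also have "\<dots> = (\<Sum>i<n. v $ i * cnj ((A *\<^sub>v w) $ i))"
    unfolding w_def using hermitian_mult_vec_inner[OF A v w] by (simp add: w_def)
  finally have "cmod (complex_of_real (vec_norm2 w)) = cmod (\<Sum>i<n. v $ i * cnj ((A *\<^sub>v w) $ i))"
    by simp
  then have "(vec_norm2 w)\<^sup>2 = (cmod (\<Sum>i<n. v $ i * cnj ((A *\<^sub>v w) $ i)))\<^sup>2"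
    using vec_norm2_nonneg[of w] by simp
  also have "\<dots> \<le> vec_norm2 v * vec_norm2 (A *\<^sub>v w)"
    using cmod_sum_mult_squared_le[of "\<lambda>i. v $ i" "\<lambda>i. cnj ((A *\<^sub>v w) $ i)" "{..<n}"] A v
    by (simp add: vec_norm2_def)
  finally show ?thesis by (simp add: w_def)
qed

text \<open>If \<open>t > s > 0\<close>, the powers of \<open>t / s\<close> outgrow every constant
  \<open>C\<close>; for \<open>s = 0\<close> the exponent 1 suffices. This removes constant factors
  from growth estimates.\<close>

lemma le_of_power_le:
  fixes t s C :: real
  assumes t: "0 \<le> t" and s: "0 \<le> s" and le: "\<And>k. t ^ k \<le> C * s ^ k"
  shows "t \<le> s"
proof (rule ccontr)
  assume "\<not> t \<le> s"
  show False
  proof (cases "s = 0")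
    case True
    then show False using le[of 1] \<open>\<not> t \<le> s\<close> by simp
  next
    case False
    then have s0: "s > 0" using s by simp
    then have "1 < t / s" using \<open>\<not> t \<le> s\<close> by simp
    then obtain k where "C < (t / s) ^ k" using real_arch_pow by blast
    then have "C * s ^ k < t ^ k" using s0 by (simp add: power_divide field_simps)
    then show False using le[of k] by simp
  qed
qed

lemma cmod_sum_mset_power_le:
  fixes M :: "complex multiset"
  assumes "\<And>z. z \<in># M \<Longrightarrow> cmod z \<le> r"
  shows "cmod (\<Sum>z\<in>#M. z ^ k) \<le> real (size M) * r ^ k"
  using assms
proof (induction M)
  case (add z M)
  have "cmod (z ^ k) \<le> r ^ k" using add.prems by (simp add: norm_power power_mono)
  moreover have "cmod (\<Sum>z\<in>#M. z ^ k) \<le> real (size M) * r ^ k" using add by simp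
  ultimately show ?case using norm_triangle_ineq[of "z ^ k" "\<Sum>z\<in>#M. z ^ k"]
    by (simp add: algebra_simps)
qed simp

lemma cmod_le_spectral_radius:
  assumes A: "A \<in> carrier_mat n n" and "n > 0" "z \<in> spectrum A"
  shows "cmod z \<le> spectral_radius A"
  using spectral_radius_mem_max(2)[OF assms(1,2)] assms(3) by blast

lemma spectral_radius_nonneg:
  assumes A: "A \<in> carrier_mat n n" and "n > 0"
  shows "spectral_radius A \<ge> 0"
  using spectral_radius_mem_max(1)[OF assms] by auto

text \<open>The squared Frobenius norm of the \<open>k\<close>-th power is the sum of the
  \<open>2k\<close>-th powers of the \<open>n\<close> eigenvalues. The factor \<open>n\<close> is
  crude, but only the growth in \<open>k\<close> will matter.\<close>

lemma vec_norm2_pow_mult_le: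
  assumes A: "A \<in> carrier_mat n n" "hermitian_mat A" and n: "n > 0" and v: "v \<in> carrier_vec n"
  shows "vec_norm2 ((A ^\<^sub>m k) *\<^sub>v v) \<le> real n * vec_norm2 v * ((spectral_radius A)\<^sup>2) ^ k"
proof -
  have c: "A ^\<^sub>m k \<in> carrier_mat n n" using A by simp
  have "complex_of_real (frobenius2 (A ^\<^sub>m k)) = (\<Sum>z\<in>#proots (char_poly A). z ^ (k + k))"
    unfolding frobenius2_hermitian[OF c hermitian_mat_pow[OF A]] pow_mat_add[OF A(1), symmetric]
    by (rule mat_trace_pow[OF A(1)])
  then have "cmod (complex_of_real (frobenius2 (A ^\<^sub>m k))) \<le> real n * spectral_radius A ^ (k + k)"
    using cmod_sum_mset_power_le[of "proots (char_poly A)" "spectral_radius A" "k + k"]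
      cmod_le_spectral_radius[OF A(1) n] size_proots_char_poly[OF A(1)]
      set_mset_proots_char_poly[OF A(1)] by metis
  then have f: "frobenius2 (A ^\<^sub>m k) \<le> real n * ((spectral_radius A)\<^sup>2) ^ k"
    by (simp add: power_add power2_eq_square power_mult_distrib)
  have "vec_norm2 ((A ^\<^sub>m k) *\<^sub>v v) \<le> frobenius2 (A ^\<^sub>m k) * vec_norm2 v"
    by (rule vec_norm2_mult_le_frobenius2[OF c v])
  also have "\<dots> \<le> (real n * ((spectral_radius A)\<^sup>2) ^ k) * vec_norm2 v"
    by (rule mult_right_mono[OF f vec_norm2_nonneg])
  finally show ?thesis by (simp add: mult_ac)
qed

text \<open>The ratios of consecutive norms of \<open>A\<^sup>k v\<close> increase by log-convexity, so already the first
  one is bounded by the exponential growth rate of these norms.\<close>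

lemma vec_norm2_hermitian_mult_le:
  assumes A: "A \<in> carrier_mat n n" "hermitian_mat A" and n: "n > 0" and v: "v \<in> carrier_vec n"
  shows "vec_norm2 (A *\<^sub>v v) \<le> (spectral_radius A)\<^sup>2 * vec_norm2 v"
proof (cases "vec_norm2 v = 0")
  case True
  then show ?thesis using vec_norm2_mult_le_frobenius2[OF A(1) v] by simp
next
  case False
  then have v0: "vec_norm2 v > 0" using vec_norm2_nonneg[of v] by simp
  define a where "a k = vec_norm2 ((A ^\<^sub>m k) *\<^sub>v v)" for k
  define t where "t = a 1 / a 0"
  have a0: "a 0 = vec_norm2 v" using A v by (simp add: a_def)
  have a1: "a 1 = vec_norm2 (A *\<^sub>v v)" using A v by (simp add: a_def)
  have nonneg: "a k \<ge> 0" for k by (simp add: a_def vec_norm2_nonneg)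
  have step: "(A ^\<^sub>m Suc k) *\<^sub>v v = A *\<^sub>v ((A ^\<^sub>m k) *\<^sub>v v)" for k
    using pow_mat_add[OF A(1), of 1 k] A v by (simp add: assoc_mult_mat_vec[of _ n n _ n])
  have conv: "(a (Suc k))\<^sup>2 \<le> a k * a (Suc (Suc k))" for k
    unfolding a_def step using A v
    by (intro vec_norm2_mult_log_convex) (auto simp: mult_mat_vec_carrier[of _ n n])
  \<comment> \<open>Log-convexity carries the ratio bound from \<open>k\<close> to
    \<open>Suc k\<close>. If \<open>a (Suc k)\<close> is zero the bound is trivial; otherwise
    \<open>conv\<close> forces \<open>a k > 0\<close>, so that it can be cancelled.\<close>
  have mono: "t * a k \<le> a (Suc k)" for k
  proof (induction k)
    case 0
    then show ?case using v0 by (simp add: t_def a0)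
  next
    case (Suc k)
    show ?case
    proof (cases "a (Suc k) = 0")
      case True
      then show ?thesis using nonneg by simp
    next
      case False
      then have p: "a (Suc k) > 0" using nonneg[of "Suc k"] by simp
      have k: "a k > 0"
      proof (rule ccontr)
        assume "\<not> a k > 0"
        then have "a k = 0" using nonneg[of k] by simp
        then show False using conv[of k] p by simp
      qed
      have "a k * (t * a (Suc k)) \<le> (a (Suc k))\<^sup>2"
        using mult_right_mono[OF Suc nonneg[of "Suc k"]] by (simp add: power2_eq_square mult_ac)
      also note conv[of k]
      finally show ?thesis using k by simp
    qed
  qed
  have t0: "t \<ge> 0" by (simp add: t_def nonneg)
  have growth: "t ^ k * a 0 \<le> a k" for k
  proof (induction k)
    case (Suc k)
    have "t ^ Suc k * a 0 \<le> t * a k" using mult_left_mono[OF Suc t0] by (simp add: mult_ac)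
    also note mono[of k]
    finally show ?case .
  qed simp
  \<comment> \<open>The lower bound from the ratios meets the upper bound from the traces, so
    \<open>t\<close> cannot exceed the exponential rate.\<close>
  have "t ^ k * a 0 \<le> (real n * ((spectral_radius A)\<^sup>2) ^ k) * a 0" for k
    using order_trans[OF growth[of k] vec_norm2_pow_mult_le[OF A n v, of k, folded a_def a0]]
    by (simp add: mult_ac)
  then have "t ^ k \<le> real n * ((spectral_radius A)\<^sup>2) ^ k" for k
    using v0 unfolding a0 by simp
  then have "t \<le> (spectral_radius A)\<^sup>2" by (intro le_of_power_le[OF t0]) auto
  then show ?thesis using v0 unfolding t_def a0 a1 by (simp add: field_simps)
qed

section \<open>Eigenvalues of Hermitian matrices and of their entrywise modulus\<close>

lemma spectrumE:
  assumes "A \<in> carrier_mat n n" "z \<in> spectrum A"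
  obtains x where "x \<in> carrier_vec n" "x \<noteq> 0\<^sub>v n" "A *\<^sub>v x = z \<cdot>\<^sub>v x"
  using assms unfolding spectrum_def eigenvalue_def eigenvector_def by auto

text \<open>Evaluating the inner product of \<open>A x\<close> and \<open>x\<close> from either side
  gives \<open>z\<close> and \<open>cnj z\<close> times the same nonzero squared norm.\<close>

lemma hermitian_eigenvalue_real:
  assumes A: "A \<in> carrier_mat n n" "hermitian_mat A" and z: "z \<in> spectrum A"
  shows "cnj z = z"
proof -
  obtain x where x: "x \<in> carrier_vec n" "x \<noteq> 0\<^sub>v n" "A *\<^sub>v x = z \<cdot>\<^sub>v x"
    using spectrumE[OF A(1) z] .
  have n2: "(\<Sum>i<n. x $ i * cnj (x $ i)) = complex_of_real (vec_norm2 x)"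
    using x by (simp add: vec_norm2_def complex_mult_cnj cmod_power2)
  have "z * complex_of_real (vec_norm2 x) = (\<Sum>i<n. (A *\<^sub>v x) $ i * cnj (x $ i))"
    using x by (simp add: sum_distrib_left mult.assoc flip: n2)
  also have "\<dots> = (\<Sum>i<n. x $ i * cnj ((A *\<^sub>v x) $ i))"
    by (rule hermitian_mult_vec_inner[OF A x(1) x(1)])
  also have "\<dots> = cnj z * complex_of_real (vec_norm2 x)"
    using x by (simp add: sum_distrib_left mult_ac flip: n2)
  finally show ?thesis using x vec_norm2_eq_0_iff[of x] by auto
qed

lemma hermitian_eigenvalue_square:
  assumes "A \<in> carrier_mat n n" "hermitian_mat A" "z \<in> spectrum A"
  shows "z\<^sup>2 = complex_of_real ((cmod z)\<^sup>2)"
  using hermitian_eigenvalue_real[OF assms] complex_norm_square[of z] by (simp add: power2_eq_square)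

text \<open>The squared Frobenius norm of \<open>A\<^sup>3 - c A\<close> is the sum of \<open>(z\<^sup>3 - c z)\<^sup>2\<close> over the eigenvalues.\<close>

lemma hermitian_cube_eq:
  assumes A: "A \<in> carrier_mat n n" "hermitian_mat A"
    and ev: "\<And>z. z \<in> spectrum A \<Longrightarrow> z ^ 3 = complex_of_real c * z"
    and ij: "i < n" "j < n"
  shows "(A ^\<^sub>m 3) $$ (i, j) = complex_of_real c * A $$ (i, j)"
proof -
  let ?T = "A ^\<^sub>m 3" and ?c = "complex_of_real c"
  define D where "D i j = ?T $$ (i, j) - ?c * A $$ (i, j)" for i j
  have T: "?T \<in> carrier_mat n n" using A by simp
  note hT = hermitian_mat_pow[OF A, of 3]
  have tr: "mat_trace (A ^\<^sub>m k * A ^\<^sub>m l) = (\<Sum>z\<in>#proots (char_poly A). z ^ (k + l))" for k l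
    unfolding pow_mat_add[OF A(1), symmetric] by (rule mat_trace_pow[OF A(1)])
  have A1: "A ^\<^sub>m 1 = A" using A by simp
  have "complex_of_real (\<Sum>i<n. \<Sum>j<n. (cmod (D i j))\<^sup>2) = (\<Sum>i<n. \<Sum>j<n. D i j * cnj (D i j))"
    by (simp add: complex_mult_cnj cmod_power2)
  also have "\<dots> = (\<Sum>i<n. \<Sum>j<n. ?T $$ (i, j) * cnj (?T $$ (i, j)) - ?c * (?T $$ (i, j) * cnj (A $$ (i, j)))
      - ?c * (A $$ (i, j) * cnj (?T $$ (i, j))) + ?c\<^sup>2 * (A $$ (i, j) * cnj (A $$ (i, j))))"
    by (intro sum.cong refl) (simp add: D_def algebra_simps power2_eq_square)
  also have "\<dots> = mat_trace (?T * ?T) - ?c * mat_trace (?T * A) - ?c * mat_trace (A * ?T) + ?c\<^sup>2 * mat_trace (A * A)"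
    using A T hT by (simp add: mat_trace_mult_hermitian[of _ n] sum.distrib sum_subtractf sum_distrib_left)
  also have "\<dots> = (\<Sum>z\<in>#proots (char_poly A). z ^ 6) - ?c * (\<Sum>z\<in>#proots (char_poly A). z ^ 4)
      - ?c * (\<Sum>z\<in>#proots (char_poly A). z ^ 4) + ?c\<^sup>2 * (\<Sum>z\<in>#proots (char_poly A). z ^ 2)"
    using tr[of 3 3] tr[of 3 1] tr[of 1 3] tr[of 1 1] unfolding A1 by (simp add: power2_eq_square)
  also have "\<dots> = (\<Sum>z\<in>#proots (char_poly A). (z ^ 3 - ?c * z)\<^sup>2)"
  proof -
    \<comment> \<open>Stated for an arbitrary multiset, because induction cannot run over the roots
      of a fixed polynomial.\<close>
    have "(\<Sum>z\<in>#M. z ^ 6) - ?c * (\<Sum>z\<in>#M. z ^ 4) - ?c * (\<Sum>z\<in>#M. z ^ 4) + ?c\<^sup>2 * (\<Sum>z\<in>#M. z ^ 2)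
        = (\<Sum>z\<in>#M. (z ^ 3 - ?c * z)\<^sup>2)" for M
      by (induction M) (simp_all add: algebra_simps eval_nat_numeral)
    then show ?thesis .
  qed
  also have "\<dots> = (\<Sum>z\<in>#proots (char_poly A). 0)"
    using ev by (intro arg_cong[where f=sum_mset] image_mset_cong) (simp add: set_mset_proots_char_poly[OF A(1)])
  finally have "complex_of_real (\<Sum>i<n. \<Sum>j<n. (cmod (D i j))\<^sup>2) = complex_of_real 0"
    by (simp only: sum_mset.neutral_const of_real_0)
  then have "(\<Sum>i<n. \<Sum>j<n. (cmod (D i j))\<^sup>2) = 0" by (simp only: of_real_eq_iff)
  then have "D i j = 0" using ij by (simp add: sum_nonneg_eq_0_iff sum_nonneg)
  then show ?thesis by (simp add: D_def)
qed

text \<open>With \<open>B = |A|\<close> entrywise, the vector \<open>|x|\<close> satisfies \<open>|z| |x| \<le> B |x|\<close>; compare norms.\<close>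

lemma eigenvalue_abs_mat:
  fixes A :: "complex mat"
  defines "B \<equiv> map_mat (\<lambda>a. complex_of_real (cmod a)) A"
  assumes A: "A \<in> carrier_mat n n" "hermitian_mat A" and n: "n > 0"
    and x: "x \<in> carrier_vec n" "x \<noteq> 0\<^sub>v n" "A *\<^sub>v x = z \<cdot>\<^sub>v x"
  shows "cmod z \<le> spectral_radius B"
    and "cmod z = spectral_radius B \<Longrightarrow> i < n \<Longrightarrow>
      (\<Sum>j<n. cmod (A $$ (i, j) * x $ j)) = spectral_radius B * cmod (x $ i)"
proof -
  define r where "r i = (\<Sum>j<n. cmod (A $$ (i, j) * x $ j))" for i
  define y where "y = map_vec (\<lambda>a. complex_of_real (cmod a)) x"
  have B: "B \<in> carrier_mat n n" using A by (simp add: B_def)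
  have hB: "hermitian_mat B"
  proof (rule hermitian_matI)
    fix i j assume "i < dim_row B" "j < dim_row B"
    then have ij: "i < n" "j < n" using B by auto
    have "A $$ (i, j) = cnj (A $$ (j, i))" using ij A by (intro hermitian_matD) auto
    then have "cmod (A $$ (i, j)) = cmod (A $$ (j, i))" by (metis complex_mod_cnj)
    then show "B $$ (i, j) = cnj (B $$ (j, i))" using ij A by (simp add: B_def)
  qed
  have y: "y \<in> carrier_vec n" using x by (simp add: y_def)
  have By: "(B *\<^sub>v y) $ i = complex_of_real (r i)" if "i < n" for i
  proof -
    have "(B *\<^sub>v y) $ i = (\<Sum>l<n. B $$ (i, l) * y $ l)" by (rule index_mult_mat_vec_sum[OF B y that])
    also have "\<dots> = complex_of_real (r i)"
      using A x that by (simp add: B_def y_def r_def norm_mult)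
    finally show ?thesis .
  qed
  have r0: "r i \<ge> 0" for i by (simp add: r_def sum_nonneg)
  have le: "cmod z * cmod (x $ i) \<le> r i" if "i < n" for i
  proof -
    have "z * x $ i = (\<Sum>l<n. A $$ (i, l) * x $ l)"
      using index_mult_mat_vec_sum[OF A(1) x(1) that] x that by simp
    then show ?thesis unfolding r_def by (metis norm_mult norm_sum)
  qed
  have s: "(\<Sum>i<n. (r i)\<^sup>2) \<le> (spectral_radius B)\<^sup>2 * vec_norm2 x"
  proof -
    have "(\<Sum>i<n. (r i)\<^sup>2) = vec_norm2 (B *\<^sub>v y)"
      using B By r0 by (simp add: vec_norm2_def del: index_mult_mat_vec)
    also have "\<dots> \<le> (spectral_radius B)\<^sup>2 * vec_norm2 y"
      by (rule vec_norm2_hermitian_mult_le[OF B hB n y])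
    also have "vec_norm2 y = vec_norm2 x" by (simp add: vec_norm2_def y_def)
    finally show ?thesis .
  qed
  have le2: "(cmod z * cmod (x $ i))\<^sup>2 \<le> (r i)\<^sup>2" if "i < n" for i
    using le[OF that] by (intro power_mono) auto
  have eq: "(\<Sum>i<n. (cmod z * cmod (x $ i))\<^sup>2) = (cmod z)\<^sup>2 * vec_norm2 x"
    using x by (simp add: vec_norm2_def power_mult_distrib sum_distrib_left)
  \<comment> \<open>Together with \<open>s\<close> this encloses the squared norm of
    \<open>B |x|\<close> between those of \<open>z x\<close> and \<open>spectral_radius B\<close>
    times \<open>x\<close>.\<close>
  have le3: "(cmod z)\<^sup>2 * vec_norm2 x \<le> (\<Sum>i<n. (r i)\<^sup>2)"
    unfolding eq[symmetric] by (intro sum_mono le2) simp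
  have "vec_norm2 x > 0" using x vec_norm2_eq_0_iff[of x] vec_norm2_nonneg[of x] by (auto simp: less_le)
  then have "(cmod z)\<^sup>2 \<le> (spectral_radius B)\<^sup>2" using order_trans[OF le3 s] by simp
  then show "cmod z \<le> spectral_radius B"
    by (rule power2_le_imp_le[OF _ spectral_radius_nonneg[OF B n]])
  assume *: "cmod z = spectral_radius B" "i < n"
  \<comment> \<open>When \<open>z\<close> is extremal the two ends of the enclosure agree, so each
    termwise inequality \<open>le2\<close> must be an equality.\<close>
  have "(\<Sum>i<n. (cmod z * cmod (x $ i))\<^sup>2) = (\<Sum>i<n. (r i)\<^sup>2)"
    unfolding eq using le3 s *(1) by simp
  then have "(cmod z * cmod (x $ i))\<^sup>2 = (r i)\<^sup>2"
    by (rule sum_mono_inv) (use le2 *(2) in auto)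
  then show "r i = spectral_radius B * cmod (x $ i)"
    using r0[of i] *(1) by (metis norm_ge_zero mult_nonneg_nonneg power2_eq_imp_eq)
qed

section \<open>Equality cases for sums\<close>

text \<open>The two claims share one induction, since the criterion for vanishing needs the
  nonnegativity of the remaining sum.\<close>

lemma sum_mset_nonneg_eq_0_iff:
  fixes f :: "'b \<Rightarrow> real"
  assumes "\<And>x. x \<in># M \<Longrightarrow> f x \<ge> 0"
  shows "(\<Sum>x\<in>#M. f x) \<ge> 0 \<and> ((\<Sum>x\<in>#M. f x) = 0 \<longleftrightarrow> (\<forall>x\<in>#M. f x = 0))"
  using assms
proof (induction M)
  case (add x M)
  then have "f x \<ge> 0" "(\<Sum>x\<in>#M. f x) \<ge> 0" "(\<Sum>x\<in>#M. f x) = 0 \<longleftrightarrow> (\<forall>x\<in>#M. f x = 0)" by auto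
  then show ?case by (auto simp: add_nonneg_eq_0_iff)
qed simp

text \<open>Equality in the triangle inequality aligns all phases. After division by the phase
  \<open>u\<close> of the total, the real parts add up to the moduli, each being at most its
  modulus; so every rotated term is real and nonnegative.\<close>

lemma sum_eq_sum_cmodD:
  assumes "finite S" "(\<Sum>q\<in>S. cmod (g q)) = cmod (\<Sum>q\<in>S. g q)" "q \<in> S"
  shows "g q = sgn (\<Sum>q\<in>S. g q) * complex_of_real (cmod (g q))"
\<comment> \<open>If the total is zero then so is every term, and the value \<open>sgn 0 = 0\<close>
  does no harm.\<close>
proof (cases "(\<Sum>q\<in>S. g q) = 0")
  case True
  then show ?thesis using assms by (simp add: sum_nonneg_eq_0_iff)
next
  case False
  define u where "u = sgn (\<Sum>q\<in>S. g q)"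
  have u: "cmod u = 1" "u * cnj u = 1" using False
    by (simp_all add: u_def norm_sgn complex_norm_square[symmetric])
  have le: "Re (g q * cnj u) \<le> cmod (g q)" for q
    using complex_Re_le_cmod[of "g q * cnj u"] u by (simp add: norm_mult)
  have "(\<Sum>q\<in>S. g q) = u * complex_of_real (cmod (\<Sum>q\<in>S. g q))"
    using False by (simp add: u_def sgn_eq)
  then have "(\<Sum>q\<in>S. g q) * cnj u = complex_of_real (cmod (\<Sum>q\<in>S. g q))"
    using u(2) by (metis mult.assoc mult.commute mult.left_neutral)
  then have "Re (\<Sum>q\<in>S. g q * cnj u) = (\<Sum>q\<in>S. cmod (g q))"
    using assms(2) by (simp add: sum_distrib_right[symmetric])
  then have "(\<Sum>q\<in>S. Re (g q * cnj u)) = (\<Sum>q\<in>S. cmod (g q))" by simp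
  then have re: "Re (g q * cnj u) = cmod (g q)"
    by (rule sum_mono_inv) (use le assms in auto)
  have "cmod (g q * cnj u) = cmod (g q)" using u by (simp add: norm_mult)
  with re have "Im (g q * cnj u) = 0" using cmod_power2[of "g q * cnj u"] by auto
  with re have "g q * cnj u = complex_of_real (cmod (g q))" by (simp add: complex_eq_iff)
  then have "g q = u * complex_of_real (cmod (g q))"
    using u(2) by (metis mult.assoc mult.commute mult.left_neutral)
  then show ?thesis by (simp add: u_def)
qed

section \<open>Complete bipartite graphs\<close>

lemma (in pair_graph) parcs_sym: "(p, q) \<in> parcs G \<Longrightarrow> (q, p) \<in> parcs G"
  using pair_sym_arcs by (auto simp: symmetric_def dest: symD)

text \<open>Without loops, every undirected edge has exactly two distinct orientations.\<close>

lemma (in pair_graph) card_parcs: "card (parcs G) = 2 * card (undirected_edges G)"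
proof -
  let ?f = "\<lambda>e::'a \<times> 'a. {fst e, snd e}"
  have im: "undirected_edges G = ?f ` parcs G"
    unfolding undirected_edges_def by force
  have fib: "card {x \<in> parcs G. ?f x = e} = 2" if e: "e \<in> ?f ` parcs G" for e
  proof -
    obtain x where "x \<in> parcs G" "e = ?f x" using e by blast
    then obtain p q where pq: "(p, q) \<in> parcs G" "e = {p, q}" by (cases x) auto
    have "{x \<in> parcs G. ?f x = e} = {(p, q), (q, p)}"
      using pq parcs_sym[OF pq(1)] by (auto simp: doubleton_eq_iff)
    moreover have "p \<noteq> q" using pair_no_loops[OF pq(1)] by simp
    ultimately show ?thesis by simp
  qed
  have "card (parcs G) = (\<Sum>x\<in>parcs G. 1)" by simp
  also have "\<dots> = (\<Sum>e\<in>?f ` parcs G. \<Sum>x\<in>{x \<in> parcs G. ?f x = e}. 1)"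
    by (rule sum.image_gen) (rule pair_finite_arcs)
  also have "\<dots> = (\<Sum>e\<in>?f ` parcs G. 2)" using fib by (intro sum.cong) auto
  also have "\<dots> = 2 * card (undirected_edges G)" by (simp add: im)
  finally show ?thesis .
qed

text \<open>A symmetric connected digraph is strongly connected, and a walk starting in
  \<open>S\<close> never leaves it. This spreads a property of vertices along edges.\<close>

lemma (in pair_graph) connected_closed_set:
  assumes "Digraph_Component.connected (with_proj G)"
    and "S \<subseteq> pverts G" "S \<noteq> {}"
    and "\<And>p q. p \<in> S \<Longrightarrow> (p, q) \<in> parcs G \<Longrightarrow> q \<in> S"
  shows "S = pverts G"
proof -
  have sc: "strongly_connected (with_proj G)"
    by (rule symmetric_connected_imp_strongly_connected[OF pair_sym_arcs assms(1)])
  obtain p where p: "p \<in> S" using assms(3) by auto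
  have "q \<in> S" if "q \<in> pverts G" for q
  proof -
    have "p \<rightarrow>\<^sup>*\<^bsub>with_proj G\<^esub> q" using sc p assms(2) that by (auto simp: strongly_connected_def)
    then show ?thesis
      by (induction rule: reachable_induct) (use p assms(4) in auto)
  qed
  then show ?thesis using assms(2) by auto
qed

text \<open>The parts are the neighbourhoods of the ends of one fixed edge. A triangle would yield a
  loop, so they are disjoint and independent; the fixed edge joins any \<open>u\<close> and
  \<open>v\<close> by a walk of length three, so they are adjacent; and a neighbour of one part lies
  in the other, so connectedness leaves no further vertices.\<close>

lemma (in pair_graph) bipartite_parts_of_three_walks:
  assumes con: "Digraph_Component.connected (with_proj G)" and ne: "parcs G \<noteq> {}"
    and walk: "\<And>p q r s. (p, q) \<in> parcs G \<Longrightarrow> (q, r) \<in> parcs G \<Longrightarrow> (r, s) \<in> parcs G \<Longrightarrow> (p, s) \<in> parcs G"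
  obtains U V where "pverts G = U \<union> V" "U \<inter> V = {}" "U \<noteq> {}" "V \<noteq> {}"
    "parcs G = U \<times> V \<union> V \<times> U"
proof -
  obtain p q where pq: "(p, q) \<in> parcs G" using ne by auto
  define U where "U = {u. (q, u) \<in> parcs G}"
  define V where "V = {v. (p, v) \<in> parcs G}"
  note sym = parcs_sym
  have loop: "(x, x) \<notin> parcs G" for x using pair_no_loops[of "(x, x)"] by auto
  have tri: False if "(x, y) \<in> parcs G" "(y, z) \<in> parcs G" "(z, x) \<in> parcs G" for x y z
    using walk[OF that] loop by blast
  have UV: "(u, v) \<in> parcs G" if "u \<in> U" "v \<in> V" for u v
    using that sym pq walk unfolding U_def V_def by blast
  have disj: "U \<inter> V = {}" unfolding U_def V_def using tri[OF pq] sym by blast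
  have all: "U \<union> V = pverts G"
  proof (rule connected_closed_set[OF con])
    show "U \<union> V \<subseteq> pverts G" by (auto simp: U_def V_def dest: in_arcsD2)
    show "U \<union> V \<noteq> {}" using pq by (auto simp: V_def)
    show "y \<in> U \<union> V" if "x \<in> U \<union> V" "(x, y) \<in> parcs G" for x y
      using that walk pq sym[OF pq] unfolding U_def V_def by blast
  qed
  have "parcs G = U \<times> V \<union> V \<times> U"
  proof
    show "U \<times> V \<union> V \<times> U \<subseteq> parcs G" using UV sym by blast
    show "parcs G \<subseteq> U \<times> V \<union> V \<times> U"
    proof
      fix e assume e: "e \<in> parcs G"
      obtain x y where xy: "e = (x, y)" by (cases e)
      have "x \<in> U \<union> V" "y \<in> U \<union> V" using e xy all in_arcsD1 in_arcsD2 by auto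
      moreover have "\<not> (x \<in> U \<and> y \<in> U)" "\<not> (x \<in> V \<and> y \<in> V)"
        using e xy tri sym unfolding U_def V_def by blast+
      ultimately show "e \<in> U \<times> V \<union> V \<times> U" using xy by blast
    qed
  qed
  moreover have "U \<noteq> {}" "V \<noteq> {}" using pq sym unfolding U_def V_def by blast+
  ultimately show ?thesis using that all disj by metis
qed

text \<open>The sizes in the definition are the cardinalities of finite parts, so size at least one
  means nonempty.\<close>

lemma complete_bipartite_iff:
  assumes "pair_graph G"
  shows "complete_bipartite G \<longleftrightarrow> (\<exists>U V. pverts G = U \<union> V \<and> U \<inter> V = {} \<and> U \<noteq> {} \<and> V \<noteq> {}
    \<and> parcs G = U \<times> V \<union> V \<times> U)"
proof -
  interpret pair_graph G by fact
  have "card U \<ge> 1 \<longleftrightarrow> U \<noteq> {}" if "U \<subseteq> pverts G" for U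
    using finite_subset[OF that pair_finite_verts] by (simp add: Suc_le_eq card_gt_0_iff)
  then show ?thesis
    unfolding complete_bipartite_def complete_bipartite_digraph_pair_def
    using pair_finite_verts by (metis Un_upper1 Un_upper2)
qed

section \<open>Eigenvalues of gain graphs\<close>

lemma sum_vertex_enum:
  assumes "vertex_enum vs G"
  shows "(\<Sum>i<length vs. f (vs ! i)) = (\<Sum>p\<in>pverts G. f p)"
  using assms by (intro sum.reindex_bij_betw bij_betw_nth) (auto simp: vertex_enum_def)

lemma vertex_enum_nth:
  "vertex_enum vs G \<Longrightarrow> p \<in> pverts G \<Longrightarrow> \<exists>i<length vs. p = vs ! i"
  by (metis in_set_conv_nth vertex_enum_def)

lemma vertex_enum_nth_mem: "vertex_enum vs G \<Longrightarrow> i < length vs \<Longrightarrow> vs ! i \<in> pverts G"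
  by (metis nth_mem vertex_enum_def)

context T_gain_graph begin

text \<open>The matrix entry indexed by vertices instead of positions in \<open>vs\<close>, which
  suits arguments about walks.\<close>

definition gain_entry :: "'a \<Rightarrow> 'a \<Rightarrow> complex" where
  "gain_entry p q = (if (p, q) \<in> parcs G then \<phi> (p, q) else 0)"

lemma gain_mult_reverse:
  assumes "(p, q) \<in> parcs G"
  shows "\<phi> (p, q) * \<phi> (q, p) = 1"
proof -
  have "\<phi> (q, p) \<noteq> 0" using gain_in_circle[OF parcs_sym[OF assms]] by auto
  then show ?thesis using gain_reverse[OF assms] by simp
qed

lemma gain_cnj:
  assumes "(p, q) \<in> parcs G"
  shows "\<phi> (p, q) = cnj (\<phi> (q, p))"
proof -
  have "\<phi> (q, p) * cnj (\<phi> (q, p)) = 1"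
    using gain_in_circle[OF parcs_sym[OF assms]] by (simp add: complex_norm_square[symmetric])
  then show ?thesis using gain_mult_reverse[OF parcs_sym[OF assms]]
    by (metis mult_cancel_left mult_zero_left zero_neq_one)
qed

lemma gain_adjacency_carrier: "gain_adjacency vs G \<phi> \<in> carrier_mat (length vs) (length vs)"
  by (simp add: gain_adjacency_def)

lemma gain_adjacency_index:
  "i < length vs \<Longrightarrow> j < length vs \<Longrightarrow> gain_adjacency vs G \<phi> $$ (i, j) = gain_entry (vs ! i) (vs ! j)"
  by (simp add: gain_adjacency_def gain_entry_def)

lemma hermitian_gain_adjacency: "hermitian_mat (gain_adjacency vs G \<phi>)"
proof (rule hermitian_matI)
  fix i j assume "i < dim_row (gain_adjacency vs G \<phi>)" "j < dim_row (gain_adjacency vs G \<phi>)"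
  then have ij: "i < length vs" "j < length vs" using gain_adjacency_carrier[of vs] by auto
  have "gain_entry (vs ! i) (vs ! j) = cnj (gain_entry (vs ! j) (vs ! i))"
    using gain_cnj[of "vs ! i" "vs ! j"] parcs_sym by (auto simp: gain_entry_def)
  then show "gain_adjacency vs G \<phi> $$ (i, j) = cnj (gain_adjacency vs G \<phi> $$ (j, i))"
    by (simp only: gain_adjacency_index ij)
qed

text \<open>Gains have modulus one; hence the comparison in \<open>eigenvalue_abs_mat\<close> is a
  comparison with \<rho>(G).\<close>

lemma abs_gain_adjacency:
  "map_mat (\<lambda>a. complex_of_real (cmod a)) (gain_adjacency vs G \<phi>) = adjacency vs G"
  by (rule eq_matI) (auto simp: gain_adjacency_def adjacency_def gain_in_circle)

text \<open>Transfers \<open>eigenvalue_abs_mat\<close> to functions on vertices. One existential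
  covers the eigenvalue equation and the extremal case, so that both speak of the same
  \<open>f\<close>.\<close>

lemma gain_eigenvector:
  assumes vs: "vertex_enum vs G" and z: "z \<in> spectrum (gain_adjacency vs G \<phi>)" and n: "length vs > 0"
  shows "cmod z \<le> graph_spectral_radius vs G"
    and "\<exists>f. (\<exists>p\<in>pverts G. f p \<noteq> 0)
      \<and> (\<forall>p\<in>pverts G. (\<Sum>q\<in>pverts G. gain_entry p q * f q) = z * f p)
      \<and> (cmod z = graph_spectral_radius vs G \<longrightarrow> (\<forall>p\<in>pverts G.
           (\<Sum>q\<in>pverts G. cmod (gain_entry p q * f q)) = cmod z * cmod (f p)))"
proof -
  let ?A = "gain_adjacency vs G \<phi>" and ?n = "length vs"
  obtain x where x: "x \<in> carrier_vec ?n" "x \<noteq> 0\<^sub>v ?n" "?A *\<^sub>v x = z \<cdot>\<^sub>v x"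
    using spectrumE[OF gain_adjacency_carrier z] .
  note e = eigenvalue_abs_mat[OF gain_adjacency_carrier hermitian_gain_adjacency n x,
      unfolded abs_gain_adjacency, folded graph_spectral_radius_def]
  show "cmod z \<le> graph_spectral_radius vs G" by (rule e(1))
  have inj: "inj_on ((!) vs) {..<?n}" using vs by (auto simp: vertex_enum_def intro: inj_on_nth)
  \<comment> \<open>Inverting the labelling \<open>vs\<close> turns coordinates into a function on
    vertices.\<close>
  define f where "f p = x $ inv_into {..<?n} ((!) vs) p" for p
  have f: "f (vs ! i) = x $ i" if "i < ?n" for i
    using inv_into_f_f[OF inj] that by (simp add: f_def)
  have 1: "\<exists>p\<in>pverts G. f p \<noteq> 0"
  proof -
    obtain i where i: "i < ?n" "x $ i \<noteq> 0" using x(1,2) by (auto simp: vec_eq_iff)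
    then show ?thesis using f[OF i(1)] vertex_enum_nth_mem[OF vs i(1)] by metis
  qed
  have 2: "(\<Sum>q\<in>pverts G. gain_entry p q * f q) = z * f p" if p: "p \<in> pverts G" for p
  proof -
    obtain i where i: "i < ?n" "p = vs ! i" using vertex_enum_nth[OF vs p] by auto
    have "z * x $ i = (\<Sum>j<?n. ?A $$ (i, j) * x $ j)"
      using index_mult_mat_vec_sum[OF gain_adjacency_carrier x(1) i(1)] x i(1) by simp
    also have "\<dots> = (\<Sum>j<?n. gain_entry p (vs ! j) * f (vs ! j))"
      using i f by (intro sum.cong) (auto simp: gain_adjacency_index)
    also have "\<dots> = (\<Sum>q\<in>pverts G. gain_entry p q * f q)" by (rule sum_vertex_enum[OF vs])
    finally show ?thesis using f[OF i(1)] i(2) by simp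
  qed
  have 3: "(\<Sum>q\<in>pverts G. cmod (gain_entry p q * f q)) = cmod z * cmod (f p)"
    if p: "p \<in> pverts G" and eq: "cmod z = graph_spectral_radius vs G" for p
  proof -
    obtain i where i: "i < ?n" "p = vs ! i" using vertex_enum_nth[OF vs p] by auto
    have "cmod z * cmod (x $ i) = (\<Sum>j<?n. cmod (?A $$ (i, j) * x $ j))"
      using e(2)[OF eq i(1)] eq by simp
    also have "\<dots> = (\<Sum>j<?n. cmod (gain_entry p (vs ! j) * f (vs ! j)))"
      using i f by (intro sum.cong) (auto simp: gain_adjacency_index)
    also have "\<dots> = (\<Sum>q\<in>pverts G. cmod (gain_entry p q * f q))"
      by (rule sum_vertex_enum[OF vs, of "\<lambda>q. cmod (gain_entry p q * f q)"])
    finally show ?thesis using f[OF i(1)] i(2) by simp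
  qed
  from 1 2 3 show "\<exists>f. (\<exists>p\<in>pverts G. f p \<noteq> 0)
      \<and> (\<forall>p\<in>pverts G. (\<Sum>q\<in>pverts G. gain_entry p q * f q) = z * f p)
      \<and> (cmod z = graph_spectral_radius vs G \<longrightarrow> (\<forall>p\<in>pverts G.
           (\<Sum>q\<in>pverts G. cmod (gain_entry p q * f q)) = cmod z * cmod (f p)))"
    by blast
qed

section \<open>Power sums, walks and the energy bound\<close>

text \<open>Both sides are the squared Frobenius norm, to which every oriented edge contributes
  one.\<close>

lemma sum_power2_eigenvalues:
  assumes vs: "vertex_enum vs G"
  shows "(\<Sum>z\<in>#proots (char_poly (gain_adjacency vs G \<phi>)). z\<^sup>2) = complex_of_real (real (card (parcs G)))"
proof -
  let ?A = "gain_adjacency vs G \<phi>" and ?n = "length vs"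
  note A = gain_adjacency_carrier[of vs] hermitian_gain_adjacency[of vs]
  have "?A ^\<^sub>m 2 = ?A * ?A" using A by (simp add: numeral_2_eq_2)
  then have "(\<Sum>z\<in>#proots (char_poly ?A). z\<^sup>2) = complex_of_real (frobenius2 ?A)"
    unfolding frobenius2_hermitian[OF A] using mat_trace_pow[OF A(1), of 2] by simp
  also have "frobenius2 ?A = (\<Sum>i<?n. \<Sum>j<?n. if (vs ! i, vs ! j) \<in> parcs G then 1 else 0)"
    unfolding frobenius2_def gain_adjacency_def by (auto intro!: sum.cong simp: gain_in_circle)
  also have "\<dots> = (\<Sum>p\<in>pverts G. \<Sum>q\<in>pverts G. if (p, q) \<in> parcs G then 1 else 0)"
    unfolding sum_vertex_enum[OF vs, of "\<lambda>q. if (p, q) \<in> parcs G then 1 else 0" for p]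
    by (rule sum_vertex_enum[OF vs])
  also have "\<dots> = (\<Sum>e\<in>pverts G \<times> pverts G. if e \<in> parcs G then 1 else 0)"
    by (simp add: sum.cartesian_product)
  also have "\<dots> = real (card (parcs G))"
    using pair_finite_verts in_arcsD1 in_arcsD2
    by (subst sum.inter_restrict[symmetric]) (auto intro!: arg_cong[where f=card])
  finally show ?thesis .
qed

text \<open>A sum of gains over walks of length three: the product vanishes unless all three pairs
  are edges.\<close>

lemma gain_adjacency_cube_index:
  assumes vs: "vertex_enum vs G" and "i < length vs" "j < length vs"
  shows "(gain_adjacency vs G \<phi> ^\<^sub>m 3) $$ (i, j) =
    (\<Sum>r\<in>pverts G. \<Sum>s\<in>pverts G. gain_entry (vs ! i) s * gain_entry s r * gain_entry r (vs ! j))"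
proof -
  let ?A = "gain_adjacency vs G \<phi>" and ?n = "length vs"
  note A = gain_adjacency_carrier[of vs]
  have "?A ^\<^sub>m 3 = ?A * ?A * ?A" using A by (simp add: numeral_3_eq_3)
  then have "(?A ^\<^sub>m 3) $$ (i, j) = (\<Sum>k<?n. (?A * ?A) $$ (i, k) * ?A $$ (k, j))"
    using assms A by (simp only: index_mult_mat_sum[of _ ?n ?n _ ?n] mult_carrier_mat[OF A A])
  also have "\<dots> = (\<Sum>k<?n. \<Sum>l<?n. gain_entry (vs ! i) (vs ! l) * gain_entry (vs ! l) (vs ! k) * gain_entry (vs ! k) (vs ! j))"
    unfolding sum_distrib_right[symmetric]
    using assms by (intro sum.cong refl) (auto simp: index_mult_mat_sum[OF A A] gain_adjacency_index simp del: index_mult_mat)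
  finally show ?thesis
    unfolding sum_vertex_enum[OF vs, of "\<lambda>s. gain_entry (vs ! i) s * gain_entry s r * gain_entry r (vs ! j)" for r]
    using sum_vertex_enum[OF vs, of "\<lambda>r. \<Sum>s\<in>pverts G. gain_entry (vs ! i) s * gain_entry s r * gain_entry r (vs ! j)"]
    by (rule trans)
qed

lemma vertex_enum_length_pos: "vertex_enum vs G \<Longrightarrow> parcs G \<noteq> {} \<Longrightarrow> length vs > 0"
  using in_arcsD1 by (fastforce simp: vertex_enum_def)

lemma sum_cmod_power2_eigenvalues:
  assumes vs: "vertex_enum vs G"
  shows "(\<Sum>z\<in>#proots (char_poly (gain_adjacency vs G \<phi>)). (cmod z)\<^sup>2) = 2 * real (card (undirected_edges G))"
proof -
  let ?M = "proots (char_poly (gain_adjacency vs G \<phi>))"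
  have "complex_of_real (\<Sum>z\<in>#?M. (cmod z)\<^sup>2) = (\<Sum>z\<in>#?M. complex_of_real ((cmod z)\<^sup>2))"
  proof -
    have "complex_of_real (\<Sum>z\<in>#M. (cmod z)\<^sup>2) = (\<Sum>z\<in>#M. complex_of_real ((cmod z)\<^sup>2))" for M
      by (induction M) simp_all
    then show ?thesis .
  qed
  also have "\<dots> = (\<Sum>z\<in>#?M. z\<^sup>2)"
    using hermitian_eigenvalue_square[OF gain_adjacency_carrier hermitian_gain_adjacency]
    by (intro arg_cong[where f=sum_mset] image_mset_cong)
      (simp add: set_mset_proots_char_poly[OF gain_adjacency_carrier])
  also have "\<dots> = complex_of_real (real (card (parcs G)))"
    by (rule sum_power2_eigenvalues[OF vs])
  finally show ?thesis unfolding of_real_eq_iff by (simp add: card_parcs)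
qed

lemma nonzero_eigenvalue:
  assumes vs: "vertex_enum vs G" and ne: "parcs G \<noteq> {}"
  shows "\<exists>z\<in>spectrum (gain_adjacency vs G \<phi>). z \<noteq> 0"
proof (rule ccontr)
  assume "\<not> ?thesis"
  then have "(\<Sum>z\<in>#proots (char_poly (gain_adjacency vs G \<phi>)). (cmod z)\<^sup>2) = 0"
    by (subst sum_mset_nonneg_eq_0_iff[THEN conjunct2])
      (auto simp: set_mset_proots_char_poly[OF gain_adjacency_carrier])
  then have "card (parcs G) = 0" unfolding sum_cmod_power2_eigenvalues[OF vs] by (simp add: card_parcs)
  then show False using ne pair_finite_arcs by simp
qed

text \<open>Makes the quotient in the bound a genuine one. A nonzero eigenvalue of the gain matrix
  exists, and its modulus is at most \<rho>(G).\<close>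

lemma graph_spectral_radius_pos:
  assumes vs: "vertex_enum vs G" and ne: "parcs G \<noteq> {}"
  shows "graph_spectral_radius vs G > 0"
proof -
  obtain z where "z \<in> spectrum (gain_adjacency vs G \<phi>)" "z \<noteq> 0" using nonzero_eigenvalue[OF assms] by auto
  then show ?thesis using gain_eigenvector(1)[OF vs _ vertex_enum_length_pos[OF assms]]
    by (meson less_le_trans zero_less_norm_iff)
qed

text \<open>The quantities \<open>cmod z * (?r - cmod z)\<close> are nonnegative and add up to
  \<open>?r\<close> times the excess of the energy over \<open>b\<close>. The excess vanishes
  exactly when each of them does.\<close>

lemma gain_energy_bound:
  assumes vs: "vertex_enum vs G" and ne: "parcs G \<noteq> {}"
  defines "b \<equiv> 2 * real (card (undirected_edges G)) / graph_spectral_radius vs G"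
  shows "gain_energy vs G \<phi> \<ge> b"
    and "gain_energy vs G \<phi> = b \<longleftrightarrow>
      (\<forall>z\<in>spectrum (gain_adjacency vs G \<phi>). z = 0 \<or> cmod z = graph_spectral_radius vs G)"
proof -
  let ?M = "proots (char_poly (gain_adjacency vs G \<phi>))" and ?r = "graph_spectral_radius vs G"
  note r = graph_spectral_radius_pos[OF vs ne]
  have le: "cmod z \<le> ?r" if "z \<in># ?M" for z
    using gain_eigenvector(1)[OF vs _ vertex_enum_length_pos[OF vs ne]] that
    by (simp add: set_mset_proots_char_poly[OF gain_adjacency_carrier])
  have split: "(\<Sum>z\<in>#M. cmod z * (?r - cmod z)) = ?r * (\<Sum>z\<in>#M. cmod z) - (\<Sum>z\<in>#M. (cmod z)\<^sup>2)" for M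
    by (induction M) (simp_all add: algebra_simps power2_eq_square)
  have eq: "(\<Sum>z\<in>#?M. cmod z * (?r - cmod z)) = ?r * (gain_energy vs G \<phi> - b)"
    unfolding split gain_energy_def[symmetric] sum_cmod_power2_eigenvalues[OF vs] b_def
    using r by (simp add: algebra_simps)
  have nn: "cmod z * (?r - cmod z) \<ge> 0" if "z \<in># ?M" for z using le[OF that] by simp
  note s = sum_mset_nonneg_eq_0_iff[of ?M "\<lambda>z. cmod z * (?r - cmod z)", OF nn, unfolded eq]
  show "gain_energy vs G \<phi> \<ge> b" using s r by (simp add: zero_le_mult_iff)
  have "gain_energy vs G \<phi> = b \<longleftrightarrow> ?r * (gain_energy vs G \<phi> - b) = 0" using r by simp
  also have "\<dots> \<longleftrightarrow> (\<forall>z\<in>#?M. cmod z * (?r - cmod z) = 0)" using s by blast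
  also have "\<dots> \<longleftrightarrow> (\<forall>z\<in>spectrum (gain_adjacency vs G \<phi>). z = 0 \<or> cmod z = ?r)"
    unfolding set_mset_proots_char_poly[OF gain_adjacency_carrier] by auto
  finally show "gain_energy vs G \<phi> = b \<longleftrightarrow>
      (\<forall>z\<in>spectrum (gain_adjacency vs G \<phi>). z = 0 \<or> cmod z = ?r)" .
qed

text \<open>An eigenvalue of modulus \<open>\<rho>(G)\<close> makes every triangle inequality in \<open>|A x| \<le> |A| |x|\<close> an
  equality, so the phases of the eigenvector determine the gains.\<close>

lemma gain_of_extremal_eigenvalue:
  assumes vs: "vertex_enum vs G" and con: "Digraph_Component.connected (with_proj G)"
    and ne: "parcs G \<noteq> {}"
    and z: "z \<in> spectrum (gain_adjacency vs G \<phi>)" "cmod z = graph_spectral_radius vs G"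
  shows "\<exists>\<theta>. (\<forall>p\<in>pverts G. cmod (\<theta> p) = 1) \<and> (\<forall>p q. (p, q) \<in> parcs G \<longrightarrow> \<phi> (p, q) = sgn z * \<theta> p * cnj (\<theta> q))"
proof -
  have z0: "cmod z > 0" using graph_spectral_radius_pos[OF vs ne] z(2) by simp
  obtain f where f: "\<exists>p\<in>pverts G. f p \<noteq> 0"
    and ev: "\<And>p. p \<in> pverts G \<Longrightarrow> (\<Sum>q\<in>pverts G. gain_entry p q * f q) = z * f p"
    and abs: "\<And>p. p \<in> pverts G \<Longrightarrow> (\<Sum>q\<in>pverts G. cmod (gain_entry p q * f q)) = cmod z * cmod (f p)"
    using gain_eigenvector(2)[OF vs z(1) vertex_enum_length_pos[OF vs ne]] z(2) by blast
  \<comment> \<open>The support of \<open>f\<close> is closed under adjacency: a neighbour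
    \<open>q\<close> of \<open>p\<close> has a positive term in its sum of moduli, which equals
    \<open>cmod z * cmod (f q)\<close>.\<close>
  have "{p \<in> pverts G. f p \<noteq> 0} = pverts G"
  proof (rule connected_closed_set[OF con])
    show "q \<in> {p \<in> pverts G. f p \<noteq> 0}" if "p \<in> {p \<in> pverts G. f p \<noteq> 0}" "(p, q) \<in> parcs G" for p q
    proof -
      have q: "q \<in> pverts G" using that in_arcsD2 by auto
      have qp: "(q, p) \<in> parcs G" using that parcs_sym by auto
      have "0 < cmod (gain_entry q p * f p)"
        using that qp gain_in_circle[OF qp] by (auto simp: gain_entry_def)
      also have "\<dots> \<le> (\<Sum>r\<in>pverts G. cmod (gain_entry q r * f r))"
        using that by (intro member_le_sum) (auto simp: pair_finite_verts)
      also have "\<dots> = cmod z * cmod (f q)" by (rule abs[OF q])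
      finally show ?thesis using q by auto
    qed
  qed (use f in auto)
  then have nz: "f p \<noteq> 0" if "p \<in> pverts G" for p using that by blast
  define \<theta> where "\<theta> p = sgn (f p)" for p
  have \<theta>: "cmod (\<theta> p) = 1" if "p \<in> pverts G" for p using nz[OF that] by (simp add: \<theta>_def norm_sgn)
  have "\<phi> (p, q) = sgn z * \<theta> p * cnj (\<theta> q)" if pq: "(p, q) \<in> parcs G" for p q
  proof -
    have p: "p \<in> pverts G" and q: "q \<in> pverts G" using pq in_arcsD1 in_arcsD2 by auto
    \<comment> \<open>This is equality in the triangle inequality at \<open>p\<close>, so all terms
      share the phase of \<open>z * f p\<close>.\<close>
    have "(\<Sum>q\<in>pverts G. cmod (gain_entry p q * f q)) = cmod (\<Sum>q\<in>pverts G. gain_entry p q * f q)"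
      unfolding abs[OF p] ev[OF p] by (simp add: norm_mult)
    from sum_eq_sum_cmodD[OF pair_finite_verts this q]
    have "gain_entry p q * f q = sgn (z * f p) * complex_of_real (cmod (gain_entry p q * f q))"
      unfolding ev[OF p] .
    then have "\<phi> (p, q) * f q = sgn z * \<theta> p * complex_of_real (cmod (f q))"
      using pq gain_in_circle[OF pq] by (simp add: gain_entry_def norm_mult sgn_mult \<theta>_def)
    moreover have "f q = \<theta> q * complex_of_real (cmod (f q))"
      using nz[OF q] by (simp add: \<theta>_def sgn_eq)
    ultimately have "\<phi> (p, q) * \<theta> q * complex_of_real (cmod (f q)) = sgn z * \<theta> p * complex_of_real (cmod (f q))"
      by (metis mult.assoc)
    then have "\<phi> (p, q) * \<theta> q = sgn z * \<theta> p" using nz[OF q] by simp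
    moreover have "\<theta> q * cnj (\<theta> q) = 1" using \<theta>[OF q] by (simp add: complex_norm_square[symmetric])
    ultimately show ?thesis by (metis mult.assoc mult.right_neutral)
  qed
  then show ?thesis using \<theta> by blast
qed

section \<open>Equality forces balance and complete bipartiteness\<close>

text \<open>Along a walk the inner potentials cancel in pairs, leaving only those of the two ends,
  which cancel when the walk is closed.\<close>

lemma balanced_of_potential:
  assumes \<theta>: "\<And>p. p \<in> pverts G \<Longrightarrow> cmod (\<theta> p) = 1"
    and \<phi>: "\<And>p q. (p, q) \<in> parcs G \<Longrightarrow> \<phi> (p, q) = \<theta> p * cnj (\<theta> q)"
  shows "balanced G \<phi>"
proof -
  have t: "cnj (\<theta> p) * \<theta> p = 1" if "p \<in> pverts G" for p
    using \<theta>[OF that] by (simp add: mult.commute complex_norm_square[symmetric])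
  have walk: "prod_list (map \<phi> c) = \<theta> u * cnj (\<theta> v)" if "awalk u c v" for u c v
    using that
  proof (induction c arbitrary: u)
    case Nil
    then show ?case using t[of u] by (auto simp: awalk_def mult.commute)
  next
    case (Cons e c)
    then have e: "e \<in> parcs G" "fst e = u" "awalk (snd e) c v" by (auto simp: awalk_Cons_iff)
    have m: "snd e \<in> pverts G" using e(1) arc_snd_in_verts by auto
    have "prod_list (map \<phi> (e # c)) = \<theta> u * cnj (\<theta> (snd e)) * (\<theta> (snd e) * cnj (\<theta> v))"
      using Cons.IH[OF e(3)] \<phi>[of u "snd e"] e by auto
    also have "\<dots> = \<theta> u * (cnj (\<theta> (snd e)) * \<theta> (snd e)) * cnj (\<theta> v)" by (simp only: mult.assoc)
    finally show ?case using t[OF m] by simp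
  qed
  show ?thesis unfolding balanced_def
  proof (intro allI impI, elim conjE)
    fix c assume "pre_digraph.cycle (with_proj G) c"
    then obtain u where u: "awalk u c u" by (auto simp: cycle_def)
    then have "u \<in> pverts G" by (auto simp: awalk_def)
    then show "prod_list (map \<phi> c) = 1" using walk[OF u] t[of u] by (simp add: mult.commute)
  qed
qed

lemma extremal_imp_balanced_bipartite:
  assumes vs: "vertex_enum vs G" and con: "Digraph_Component.connected (with_proj G)"
    and ne: "parcs G \<noteq> {}"
    and ev: "\<And>z. z \<in> spectrum (gain_adjacency vs G \<phi>) \<Longrightarrow> z = 0 \<or> cmod z = graph_spectral_radius vs G"
  shows "balanced G \<phi> \<and> complete_bipartite G"
proof -
  let ?A = "gain_adjacency vs G \<phi>" and ?r = "graph_spectral_radius vs G"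
  note A = gain_adjacency_carrier[of vs] hermitian_gain_adjacency[of vs]
  note r = graph_spectral_radius_pos[OF vs ne]
  obtain z where z: "z \<in> spectrum ?A" "cmod z = ?r"
    using nonzero_eigenvalue[OF vs ne] ev by blast
  define s where "s = sgn z"
  obtain \<theta> where \<theta>: "\<And>p. p \<in> pverts G \<Longrightarrow> cmod (\<theta> p) = 1"
    and \<phi>: "\<And>p q. (p, q) \<in> parcs G \<Longrightarrow> \<phi> (p, q) = s * \<theta> p * cnj (\<theta> q)"
    using gain_of_extremal_eigenvalue[OF vs con ne z] unfolding s_def by blast
  have s1: "cmod s = 1" using z r by (auto simp: s_def norm_sgn)
  have sr: "cnj s = s" using hermitian_eigenvalue_real[OF A z(1)] by (simp add: s_def sgn_eq)
  have t: "cnj (\<theta> p) * \<theta> p = 1" if "p \<in> pverts G" for p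
    using \<theta>[OF that] by (simp add: mult.commute complex_norm_square[symmetric])
  have cube: "(?A ^\<^sub>m 3) $$ (i, j) = complex_of_real (?r\<^sup>2) * ?A $$ (i, j)" if "i < length vs" "j < length vs" for i j
  proof (rule hermitian_cube_eq[OF A _ that])
    fix x assume x: "x \<in> spectrum ?A"
    show "x ^ 3 = complex_of_real (?r\<^sup>2) * x"
      using ev[OF x] hermitian_eigenvalue_square[OF A x] by (auto simp: power3_eq_cube power2_eq_square)
  qed
  have walk: "(p, q) \<in> parcs G" if w: "(p, u) \<in> parcs G" "(u, v) \<in> parcs G" "(v, q) \<in> parcs G" for p u v q
  proof (rule ccontr)
    assume nadj: "(p, q) \<notin> parcs G"
    have mem: "p \<in> pverts G" "q \<in> pverts G" "u \<in> pverts G" "v \<in> pverts G"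
      using w in_arcsD1 in_arcsD2 by auto
    obtain i j where ij: "i < length vs" "j < length vs" "p = vs ! i" "q = vs ! j"
      using vertex_enum_nth[OF vs] mem(1,2) by meson
    \<comment> \<open>Indicator of the walks p, y, x, q. All of them have the same gain, so the
      entry of the cube is a unit times their number. By \<open>cube\<close> it is zero for
      nonadjacent \<open>p\<close> and \<open>q\<close>, which contradicts the walk through
      \<open>u\<close> and \<open>v\<close>.\<close>
    define N where "N x y = (if (p, y) \<in> parcs G \<and> (y, x) \<in> parcs G \<and> (x, q) \<in> parcs G then 1 else 0 :: real)" for x y
    have "gain_entry p y * gain_entry y x * gain_entry x q = s ^ 3 * \<theta> p * cnj (\<theta> q) * complex_of_real (N x y)"
      if "x \<in> pverts G" "y \<in> pverts G" for x y
    proof (cases "(p, y) \<in> parcs G \<and> (y, x) \<in> parcs G \<and> (x, q) \<in> parcs G")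
      case True
      then have "gain_entry p y * gain_entry y x * gain_entry x q
        = s ^ 3 * \<theta> p * (cnj (\<theta> y) * \<theta> y) * (cnj (\<theta> x) * \<theta> x) * cnj (\<theta> q)"
        by (simp add: gain_entry_def \<phi> power3_eq_cube mult_ac)
      then show ?thesis using True t that by (simp add: N_def)
    next
      case False
      then show ?thesis by (auto simp: gain_entry_def N_def)
    qed
    then have "(?A ^\<^sub>m 3) $$ (i, j) = (\<Sum>x\<in>pverts G. \<Sum>y\<in>pverts G. s ^ 3 * \<theta> p * cnj (\<theta> q) * complex_of_real (N x y))"
      unfolding gain_adjacency_cube_index[OF vs ij(1,2)] ij(3,4)[symmetric] by (intro sum.cong refl) auto
    also have "\<dots> = s ^ 3 * \<theta> p * cnj (\<theta> q) * complex_of_real (\<Sum>x\<in>pverts G. \<Sum>y\<in>pverts G. N x y)"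
      by (simp add: sum_distrib_left)
    finally have "s ^ 3 * \<theta> p * cnj (\<theta> q) * complex_of_real (\<Sum>x\<in>pverts G. \<Sum>y\<in>pverts G. N x y) = 0"
      using cube[OF ij(1,2)] nadj ij by (simp add: gain_adjacency_index gain_entry_def)
    then have "(\<Sum>x\<in>pverts G. \<Sum>y\<in>pverts G. N x y) = 0"
      using s1 \<theta>[OF mem(1)] \<theta>[OF mem(2)] by (auto simp del: of_real_sum)
    moreover have nn: "N x y \<ge> 0" for x y by (simp add: N_def)
    ultimately have "N v u = 0" using mem
      by (simp add: sum_nonneg_eq_0_iff sum_nonneg pair_finite_verts)
    then show False using w by (simp add: N_def split: if_splits)
  qed
  obtain U V where UV: "pverts G = U \<union> V" "U \<inter> V = {}" "U \<noteq> {}" "V \<noteq> {}" "parcs G = U \<times> V \<union> V \<times> U"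
    by (rule bipartite_parts_of_three_walks[OF con ne], erule (2) walk, rule that)
  have "complete_bipartite G"
    unfolding complete_bipartite_iff[OF pair_graph_axioms] using UV by blast
  moreover have "balanced G \<phi>"
  proof (rule balanced_of_potential)
    \<comment> \<open>Each edge has exactly one end outside \<open>U\<close>, so the factor
      \<open>s\<close> occurs once; as \<open>s\<close> is real, it may sit at either end.\<close>
    let ?\<theta> = "\<lambda>p. if p \<in> U then \<theta> p else s * \<theta> p"
    show "cmod (?\<theta> p) = 1" if "p \<in> pverts G" for p using \<theta>[OF that] s1 by (simp add: norm_mult)
    show "\<phi> (p, q) = ?\<theta> p * cnj (?\<theta> q)" if "(p, q) \<in> parcs G" for p q
      using \<phi>[OF that] that UV(2,5) sr by (auto simp: mult_ac)
  qed
  ultimately show ?thesis by simp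
qed

section \<open>Balanced complete bipartite graphs attain equality\<close>

text \<open>Applying the matrix three times at a vertex sums over walks of length three. By
  \<open>walk\<close> their gains depend only on the ends, so the two inner sums merely count
  vertices.\<close>

lemma complete_bipartite_eigenvalue:
  assumes vs: "vertex_enum vs G" and ne: "parcs G \<noteq> {}"
    and UV: "pverts G = U \<union> V" "U \<inter> V = {}" "parcs G = U \<times> V \<union> V \<times> U"
    and walk: "\<And>p q s t. (p, q) \<in> parcs G \<Longrightarrow> (q, s) \<in> parcs G \<Longrightarrow> (s, t) \<in> parcs G
      \<Longrightarrow> \<phi> (p, q) * \<phi> (q, s) * \<phi> (s, t) = \<phi> (p, t)"
    and z: "z \<in> spectrum (gain_adjacency vs G \<phi>)"
  shows "z ^ 3 = of_nat (card U * card V) * z"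
proof -
  obtain f where f: "\<exists>p\<in>pverts G. f p \<noteq> 0"
    and ev: "\<And>p. p \<in> pverts G \<Longrightarrow> (\<Sum>q\<in>pverts G. gain_entry p q * f q) = z * f p"
    using gain_eigenvector(2)[OF vs z vertex_enum_length_pos[OF vs ne]] by blast
  \<comment> \<open>Stated for both orders of the parts, since \<open>f\<close> may be nonzero on
    only one of them.\<close>
  have *: "z ^ 3 = of_nat (card X * card Y) * z"
    if XY: "pverts G = X \<union> Y" "X \<inter> Y = {}" "parcs G = X \<times> Y \<union> Y \<times> X" and p: "p \<in> X" "f p \<noteq> 0" for X Y p
  proof -
    have fin: "finite X" "finite Y" using pair_finite_verts XY(1) by auto
    have X: "z * f x = (\<Sum>y\<in>Y. \<phi> (x, y) * f y)" if "x \<in> X" for x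
    proof -
      have "(\<Sum>q\<in>pverts G. gain_entry x q * f q) = (\<Sum>y\<in>Y. \<phi> (x, y) * f y)"
        using that XY pair_finite_verts by (intro sum.mono_neutral_cong_right) (auto simp: gain_entry_def)
      then show ?thesis using ev[of x] that XY(1) by simp
    qed
    have Y: "z * f y = (\<Sum>x\<in>X. \<phi> (y, x) * f x)" if "y \<in> Y" for y
    proof -
      have "(\<Sum>q\<in>pverts G. gain_entry y q * f q) = (\<Sum>x\<in>X. \<phi> (y, x) * f x)"
        using that XY pair_finite_verts by (intro sum.mono_neutral_cong_right) (auto simp: gain_entry_def)
      then show ?thesis using ev[of y] that XY(1) by simp
    qed
    have "z ^ 3 * f p = z * (z * (z * f p))" by (simp add: power3_eq_cube)
    also have "\<dots> = (\<Sum>y\<in>Y. \<phi> (p, y) * (z * (z * f y)))"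
      by (simp add: X[OF p(1)] sum_distrib_left mult_ac)
    also have "\<dots> = (\<Sum>y\<in>Y. \<phi> (p, y) * (\<Sum>x\<in>X. \<phi> (y, x) * (z * f x)))"
      by (intro sum.cong refl) (simp add: Y sum_distrib_left mult_ac)
    also have "\<dots> = (\<Sum>y\<in>Y. \<phi> (p, y) * (\<Sum>x\<in>X. \<phi> (y, x) * (\<Sum>t\<in>Y. \<phi> (x, t) * f t)))"
      by (intro sum.cong refl arg_cong2[where f="(*)"]) (simp add: X)
    also have "\<dots> = (\<Sum>y\<in>Y. \<Sum>x\<in>X. \<Sum>t\<in>Y. (\<phi> (p, y) * \<phi> (y, x) * \<phi> (x, t)) * f t)"
      by (simp add: sum_distrib_left mult_ac)
    also have "\<dots> = (\<Sum>y\<in>Y. \<Sum>x\<in>X. \<Sum>t\<in>Y. \<phi> (p, t) * f t)"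
      using p XY(3) by (intro sum.cong refl arg_cong2[where f="(*)"] walk) auto
    also have "\<dots> = of_nat (card X * card Y) * (\<Sum>t\<in>Y. \<phi> (p, t) * f t)"
      by (simp add: mult_ac)
    also have "(\<Sum>t\<in>Y. \<phi> (p, t) * f t) = z * f p" by (rule X[OF p(1), symmetric])
    finally show ?thesis using p(2) by (simp flip: mult.assoc)
  qed
  obtain p where p: "p \<in> U \<or> p \<in> V" "f p \<noteq> 0" using f UV(1) by auto
  then show ?thesis
    using *[of U V p] *[of V U p] UV by (auto simp: Un_commute Int_commute mult.commute)
qed

text \<open>If the walk backtracks, two opposite gains cancel. Otherwise its ends lie in different
  parts, and the edge between them closes it to a 4-cycle of gain one.\<close>

lemma balanced_bipartite_three_walk:
  assumes bal: "balanced G \<phi>"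
    and UV: "pverts G = U \<union> V" "U \<inter> V = {}" "parcs G = U \<times> V \<union> V \<times> U"
    and w: "(p, q) \<in> parcs G" "(q, s) \<in> parcs G" "(s, t) \<in> parcs G"
  shows "\<phi> (p, q) * \<phi> (q, s) * \<phi> (s, t) = \<phi> (p, t)"
proof (cases "p = s \<or> q = t")
  case True
  then show ?thesis
    using gain_mult_reverse[OF w(1)] gain_mult_reverse[OF w(2)] by (auto simp: mult.assoc)
next
  case False
  have tp: "(t, p) \<in> parcs G" using w UV(2) unfolding UV(3) by auto
  let ?c = "[(p, q), (q, s), (s, t), (t, p)]"
  have "awalk p ?c p" using w tp in_arcsD1 by (auto simp: awalk_def)
  moreover have "distinct (tl (pawalk_verts p ?c))" using False w UV(2) unfolding UV(3) by auto
  ultimately have "cycle ?c" unfolding cycle_def by auto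
  then have "prod_list (map \<phi> ?c) = 1" using bal[unfolded balanced_def, rule_format, of ?c] by simp
  then have "(\<phi> (p, q) * \<phi> (q, s) * \<phi> (s, t)) * \<phi> (t, p) = 1" by (simp add: mult.assoc)
  moreover have "\<phi> (p, t) * \<phi> (t, p) = 1" using gain_mult_reverse[OF parcs_sym[OF tp]] .
  moreover have "\<phi> (t, p) \<noteq> 0" using gain_in_circle[OF tp] by auto
  ultimately show ?thesis by (metis mult_right_cancel)
qed

text \<open>Presents the ordinary adjacency matrix as a gain matrix, so that the eigenvalue lemmas
  also determine \<rho>(G).\<close>

lemma T_gain_graph_one: "T_gain_graph G (\<lambda>_. 1)"
  by unfold_locales auto

lemma balanced_bipartite_imp_extremal:
  assumes vs: "vertex_enum vs G" and ne: "parcs G \<noteq> {}"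
    and bal: "balanced G \<phi>" and bip: "complete_bipartite G"
    and z: "z \<in> spectrum (gain_adjacency vs G \<phi>)"
  shows "z = 0 \<or> cmod z = graph_spectral_radius vs G"
proof -
  obtain U V where UV: "pverts G = U \<union> V" "U \<inter> V = {}" "parcs G = U \<times> V \<union> V \<times> U"
    using bip unfolding complete_bipartite_iff[OF pair_graph_axioms] by blast
  have sq: "(cmod x)\<^sup>2 = real (card U * card V)" if "x ^ 3 = of_nat (card U * card V) * x" "x \<noteq> 0" for x
  proof -
    have "x\<^sup>2 = of_nat (card U * card V)" using that by (simp add: power3_eq_cube power2_eq_square)
    then have "cmod (x\<^sup>2) = real (card U * card V)" by (metis norm_of_nat)
    then show ?thesis by (simp add: norm_power)
  qed
  interpret one: T_gain_graph G "\<lambda>_. 1" by (rule T_gain_graph_one)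
  have B: "gain_adjacency vs G (\<lambda>_. 1) = adjacency vs G"
    by (simp add: gain_adjacency_def adjacency_def)
  \<comment> \<open>The spectral radius is attained by an eigenvalue. Its cubic equation, with all
    gains one, gives \<rho>(G) squared as the product of the sizes of the parts.\<close>
  obtain x where x: "x \<in> spectrum (adjacency vs G)" "cmod x = graph_spectral_radius vs G"
    using spectral_radius_mem_max(1)[OF one.gain_adjacency_carrier vertex_enum_length_pos[OF vs ne], unfolded B]
    unfolding graph_spectral_radius_def by auto
  have "x ^ 3 = of_nat (card U * card V) * x"
    by (rule one.complete_bipartite_eigenvalue[OF vs ne UV]) (use x(1) B in auto)
  then have "(graph_spectral_radius vs G)\<^sup>2 = real (card U * card V)"
    using sq[of x] x(2) graph_spectral_radius_pos[OF vs ne] by (metis norm_zero less_irrefl)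
  moreover have "z ^ 3 = of_nat (card U * card V) * z"
    by (rule complete_bipartite_eigenvalue[OF vs ne UV balanced_bipartite_three_walk[OF bal UV] z])
  ultimately have "z \<noteq> 0 \<Longrightarrow> (cmod z)\<^sup>2 = (graph_spectral_radius vs G)\<^sup>2" using sq by simp
  then show ?thesis
    using graph_spectral_radius_pos[OF vs ne] power2_eq_imp_eq[of "cmod z"] by force
qed

end

theorem theorem3p2:
  fixes G :: "'a pair_pre_digraph" and \<phi> :: "'a \<times> 'a \<Rightarrow> complex" and vs :: "'a list" and m :: nat
  assumes "T_gain_graph G \<phi>"
    and "Digraph_Component.connected (with_proj G)"
    and "undirected_edges G \<noteq> {}"
    and "m = card (undirected_edges G)"
    and "vertex_enum vs G"
  shows "gain_energy vs G \<phi> \<ge> 2 * real m / graph_spectral_radius vs G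
    \<and> (gain_energy vs G \<phi> = 2 * real m / graph_spectral_radius vs G
         \<longleftrightarrow> balanced G \<phi> \<and> complete_bipartite G)"
proof -
  interpret T_gain_graph G \<phi> by fact
  have ne: "parcs G \<noteq> {}" using assms(3) by (auto simp: undirected_edges_def)
  show ?thesis
    using gain_energy_bound[OF assms(5) ne] extremal_imp_balanced_bipartite[OF assms(5,2) ne]
      balanced_bipartite_imp_extremal[OF assms(5) ne]
    unfolding assms(4) by blast
qed

end
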